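(* Let $\mathcal{O}=\left((\Omega,P),\{p_\mu(\cdot):\mu\in\mathcal{M}\},\mathcal{F}\right)$ be a good observation scheme, $\mathcal{M}\subset\mathbf{R}^M$, let $K\geq1$ be an integer, let $\epsilon\in(0,1)$, let $X_1,\dots,X_I\subset\mathbf{R}^n$ be nonempty convex compact sets, let $A_j(\cdot):\mathbf{R}^n\to\mathbf{R}^M$, $1\le j\le I$, be affine mappings such that $A_j(x)\in\mathcal{M}$ whenever $x\in X_j$, and let $g\in\mathbf{R}^n$. For $1\le i,j\le I$ let $\alpha_{ij}>0$ and $\phi_{ij}\in\mathcal{F}$ be arbitrary, and let the quantities $\rho_{ij}$ and the estimate $\widehat{g}(\cdot):\Omega^K\to\mathbf{R}$ be built from the $\alpha_{ij},\phi_{ij}$ as described in the context. For $i\in\{1,\dots,I\}$ let $\rho_i=\max_{1\le j\le I}\max[\rho_{ij},\rho_{ji}]$, and let $$\rho=\max_{i}\rho_i=\max_{1\le i,j\le I}\rho_{ij}.$$ Assume that the density, taken w.r.t. $P^K=P\times\dots\times P$, of the distribution of the $K$-repeated observation $\omega^K=(\omega_1,\dots,\omega_K)$ is $p^K_{A_\ell(x)}$ for some $\ell\le I$ and $x\in X_\ell$. Then $$\mathrm{Prob}_{\omega^K\sim p^K_{A_\ell(x)}}\{|\widehat{g}(\omega^K)-g^Tx|>\rho_\ell\}\le\epsilon.$$ As a result, the $\epsilon$-risk of the estimate satisfies $\mathrm{Risk}_\epsilon[\widehat{g}(\cdot)]\le\rho$.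
   Context: **Good observation scheme.** A good observation scheme (o.s.) is a collection $\mathcal{O}=\left((\Omega,P),\{p_\mu(\cdot):\mu\in\mathcal{M}\},\mathcal{F}\right)$ where: (1) $\Omega$ is a Polish (complete metric separable) space and $P$ is a $\sigma$-finite $\sigma$-additive Borel reference measure on $\Omega$ such that $\Omega$ is the support of $P$; (2) $\mathcal{M}$ is a convex relatively open set in some $\mathbf{R}^M$, and for $\mu\in\mathcal{M}$, $p_\mu(\cdot)$ is a probability density on $\Omega$ w.r.t. $P$; the function $p_\mu(\omega)$ is positive and continuous in $(\mu,\omega)\in\mathcal{M}\times\Omega$; (3) $\mathcal{F}$ is a finite-dimensional linear subspace of the space of continuous functions on $\Omega$, containing the constants and all functions $\ln(p_\mu(\cdot)/p_\nu(\cdot))$, $\mu,\nu\in\mathcal{M}$, and such that the function $$\Phi_{\mathcal{O}}(\phi;\mu)=\ln\left(\int_\Omega e^{\phi(\omega)}p_\mu(\omega)P(d\omega)\right)$$ is real-valued on $\mathcal{F}\times\mathcal{M}$ and concave in $\mu\in\mathcal{M}$. **Repeated observations.** $p^K_\mu(\omega^K)=\prod_{k=1}^Kp_\mu(\omega_k)$ is the density w.r.t. $P^K$ of $\omega^K=(\omega_1,\dots,\omega_K)$ with $\omega_k$ drawn independently from $p_\mu$. **Risk.** A Borel function $\widehat{g}:\Omega^K\to\mathbf{R}$ is called $(\rho,\epsilon)$-reliable if $\mathrm{Prob}_{\omega^K\sim p^K_{A_j(x)}}\{|\widehat{g}(\omega^K)-g^Tx|>\rho\}\le\epsilon$ for all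 $j\le I$ and $x\in X_j$. Its $\epsilon$-risk is $\mathrm{Risk}_\epsilon[\widehat{g}]=\inf\{\rho:\widehat{g}\text{ is }(\rho,\epsilon)\text{-reliable}\}$. **The estimate.** For $1\le\ell\le I$, $\beta>0$, $\psi\in\mathcal{F}$ set $$\Psi_{\ell,+}(\beta,\psi)=\max_{x\in X_\ell}\left[K\beta\Phi_{\mathcal{O}}(\psi/\beta;A_\ell(x))-g^Tx+\beta\ln(2I/\epsilon)\right],$$ $$\Psi_{\ell,-}(\beta,\psi)=\max_{x\in X_\ell}\left[K\beta\Phi_{\mathcal{O}}(-\psi/\beta;A_\ell(x))+g^Tx+\beta\ln(2I/\epsilon)\right],$$ and, for the selected $\alpha_{ij}>0$, $\phi_{ij}\in\mathcal{F}$, $$\rho_{ij}=\tfrac12\left[\Psi_{i,+}(\alpha_{ij},\phi_{ij})+\Psi_{j,-}(\alpha_{ij},\phi_{ij})\right],\qquad \varkappa_{ij}=\tfrac12\left[\Psi_{j,-}(\alpha_{ij},\phi_{ij})-\Psi_{i,+}(\alpha_{ij},\phi_{ij})\right],$$ $$g_{ij}(\omega^K)=\sum_{k=1}^K\phi_{ij}(\omega_k)+\varkappa_{ij}.$$ The estimate is $$\widehat{g}(\omega^K)=\tfrac12\left[\min_{i\le I}r_i+\max_{j\le I}c_j\right],\qquad r_i=\max_{j\le I}g_{ij}(\omega^K),\quad c_j=\min_{i\le I}g_{ij}(\omega^K).$$ *)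

theory Defs
  imports
    "HOL-Probability.Probability"
    "HOL-Library.Function_Algebras"
begin

subsection \<open>Good observation schemes\<close>

definition fun_scale :: "real \<Rightarrow> ('w \<Rightarrow> real) \<Rightarrow> 'w \<Rightarrow> real" where
  "fun_scale c f = (\<lambda>\<omega>. c * f \<omega>)"

lemma vector_space_fun_scale: "vector_space fun_scale"
  by unfold_locales (auto simp: fun_scale_def fun_eq_iff algebra_simps)

definition finite_dim_function_space :: "('w \<Rightarrow> real) set \<Rightarrow> bool" where
  "finite_dim_function_space F \<longleftrightarrow>
     module.subspace fun_scale F \<and> (\<exists>B. finite B \<and> module.span fun_scale B = F)"

definition measure_support :: "'w::topological_space measure \<Rightarrow> 'w set" where
  "measure_support P = {\<omega>. \<forall>U. open U \<longrightarrow> \<omega> \<in> U \<longrightarrow> emeasure P U > 0}"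

definition Phi :: "'w measure \<Rightarrow> ('m \<Rightarrow> 'w \<Rightarrow> real) \<Rightarrow> ('w \<Rightarrow> real) \<Rightarrow> 'm \<Rightarrow> real" where
  "Phi P p \<phi> \<mu> = ln (\<integral>\<omega>. exp (\<phi> \<omega>) * p \<mu> \<omega> \<partial>P)"

text \<open>
  The observation space is the whole type \<^typ>\<open>'w\<close>, of class \<^class>\<open>polish_space\<close>
  (complete separable metric space). Assumption \<open>Phi_finite\<close> says that \<^const>\<open>Phi\<close> is
  real-valued: the integrand is positive, so the logarithm of its integral is a real number
  exactly when the integral is finite.
\<close>

locale good_observation_scheme = sigma_finite_measure P
  for P :: "'w::polish_space measure" +
  fixes \<M> :: "(real ^ 'm) set"
    and p :: "real ^ 'm \<Rightarrow> 'w \<Rightarrow> real"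
    and \<F> :: "('w \<Rightarrow> real) set"
  assumes sets_P: "sets P = sets borel"
    and support_P: "measure_support P = UNIV"
    and convex_M: "convex \<M>"
    and rel_open_M: "rel_open \<M>"
    and p_pos: "\<And>\<mu> \<omega>. \<mu> \<in> \<M> \<Longrightarrow> p \<mu> \<omega> > 0"
    and p_cont: "continuous_on (\<M> \<times> UNIV) (\<lambda>(\<mu>, \<omega>). p \<mu> \<omega>)"
    and p_density: "\<And>\<mu>. \<mu> \<in> \<M> \<Longrightarrow> (\<integral>\<^sup>+ \<omega>. ennreal (p \<mu> \<omega>) \<partial>P) = 1"
    and F_space: "finite_dim_function_space \<F>"
    and F_cont: "\<And>\<phi>. \<phi> \<in> \<F> \<Longrightarrow> continuous_on UNIV \<phi>"
    and F_const: "\<And>c. (\<lambda>\<omega>. c) \<in> \<F>"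
    and F_log_ratio: "\<And>\<mu> \<nu>. \<mu> \<in> \<M> \<Longrightarrow> \<nu> \<in> \<M> \<Longrightarrow> (\<lambda>\<omega>. ln (p \<mu> \<omega> / p \<nu> \<omega>)) \<in> \<F>"
    and Phi_finite: "\<And>\<phi> \<mu>. \<phi> \<in> \<F> \<Longrightarrow> \<mu> \<in> \<M> \<Longrightarrow> integrable P (\<lambda>\<omega>. exp (\<phi> \<omega>) * p \<mu> \<omega>)"
    and Phi_concave: "\<And>\<phi>. \<phi> \<in> \<F> \<Longrightarrow> concave_on \<M> (Phi P p \<phi>)"

definition affine_map :: "('a::real_vector \<Rightarrow> 'b::real_vector) \<Rightarrow> bool" where
  "affine_map f \<longleftrightarrow> (\<exists>L c. linear L \<and> (\<forall>x. f x = L x + c))"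

subsection \<open>Repeated observations and risk\<close>

text \<open>
  The \<open>K\<close>-fold power of the observation space consists of the (extensional) functions on \<open>{1..K}\<close>.
  As the observation space is second countable, the product sigma-algebra is its Borel
  sigma-algebra.
\<close>

definition obs_space :: "'w measure \<Rightarrow> nat \<Rightarrow> (nat \<Rightarrow> 'w) measure" where
  "obs_space P K = Pi\<^sub>M {1..K} (\<lambda>_. P)"

definition obs_distr ::
  "'w measure \<Rightarrow> ('m \<Rightarrow> 'w \<Rightarrow> real) \<Rightarrow> nat \<Rightarrow> 'm \<Rightarrow> (nat \<Rightarrow> 'w) measure" where
  "obs_distr P p K \<mu> = density (obs_space P K) (\<lambda>\<omega>. ennreal (\<Prod>k=1..K. p \<mu> (\<omega> k)))"

definition reliable ::
  "'w measure \<Rightarrow> ('m \<Rightarrow> 'w \<Rightarrow> real) \<Rightarrow> nat \<Rightarrow> nat \<Rightarrow> (nat \<Rightarrow> 'n::real_inner set) \<Rightarrow>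
   (nat \<Rightarrow> 'n \<Rightarrow> 'm) \<Rightarrow> 'n \<Rightarrow> ((nat \<Rightarrow> 'w) \<Rightarrow> real) \<Rightarrow> real \<Rightarrow> real \<Rightarrow> bool" where
  "reliable P p K I X A g ghat \<rho> \<epsilon> \<longleftrightarrow>
     ghat \<in> borel_measurable (obs_space P K) \<and>
     (\<forall>j\<in>{1..I}. \<forall>x\<in>X j. \<P>(\<omega> in obs_distr P p K (A j x). \<bar>ghat \<omega> - g \<bullet> x\<bar> > \<rho>) \<le> \<epsilon>)"

text \<open>Extended-real valued, so that the risk is infinite if no \<open>\<rho>\<close> is admissible.\<close>

definition Risk ::
  "'w measure \<Rightarrow> ('m \<Rightarrow> 'w \<Rightarrow> real) \<Rightarrow> nat \<Rightarrow> nat \<Rightarrow> (nat \<Rightarrow> 'n::real_inner set) \<Rightarrow>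
   (nat \<Rightarrow> 'n \<Rightarrow> 'm) \<Rightarrow> 'n \<Rightarrow> real \<Rightarrow> ((nat \<Rightarrow> 'w) \<Rightarrow> real) \<Rightarrow> ereal" where
  "Risk P p K I X A g \<epsilon> ghat = Inf {ereal \<rho> | \<rho>. reliable P p K I X A g ghat \<rho> \<epsilon>}"

subsection \<open>The estimate\<close>

text \<open>
  The suprema in \<open>Psi_plus\<close> and \<open>Psi_minus\<close> are maxima in the situation of interest: \<^const>\<open>Phi\<close>
  is finite and concave in its second argument on a relatively open convex set, hence continuous
  there, and the sets \<open>X l\<close> are nonempty and compact.
\<close>

definition Psi_plus ::
  "'w measure \<Rightarrow> ('m \<Rightarrow> 'w \<Rightarrow> real) \<Rightarrow> nat \<Rightarrow> nat \<Rightarrow> (nat \<Rightarrow> 'n::real_inner set) \<Rightarrow>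
   (nat \<Rightarrow> 'n \<Rightarrow> 'm) \<Rightarrow> 'n \<Rightarrow> real \<Rightarrow> nat \<Rightarrow> real \<Rightarrow> ('w \<Rightarrow> real) \<Rightarrow> real" where
  "Psi_plus P p K I X A g \<epsilon> l \<beta> \<psi> =
     (SUP x\<in>X l. real K * \<beta> * Phi P p (\<lambda>\<omega>. \<psi> \<omega> / \<beta>) (A l x) - g \<bullet> x + \<beta> * ln (2 * real I / \<epsilon>))"

definition Psi_minus ::
  "'w measure \<Rightarrow> ('m \<Rightarrow> 'w \<Rightarrow> real) \<Rightarrow> nat \<Rightarrow> nat \<Rightarrow> (nat \<Rightarrow> 'n::real_inner set) \<Rightarrow>
   (nat \<Rightarrow> 'n \<Rightarrow> 'm) \<Rightarrow> 'n \<Rightarrow> real \<Rightarrow> nat \<Rightarrow> real \<Rightarrow> ('w \<Rightarrow> real) \<Rightarrow> real" where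
  "Psi_minus P p K I X A g \<epsilon> l \<beta> \<psi> =
     (SUP x\<in>X l. real K * \<beta> * Phi P p (\<lambda>\<omega>. - \<psi> \<omega> / \<beta>) (A l x) + g \<bullet> x + \<beta> * ln (2 * real I / \<epsilon>))"

definition rho_pair ::
  "'w measure \<Rightarrow> ('m \<Rightarrow> 'w \<Rightarrow> real) \<Rightarrow> nat \<Rightarrow> nat \<Rightarrow> (nat \<Rightarrow> 'n::real_inner set) \<Rightarrow>
   (nat \<Rightarrow> 'n \<Rightarrow> 'm) \<Rightarrow> 'n \<Rightarrow> real \<Rightarrow> (nat \<Rightarrow> nat \<Rightarrow> real) \<Rightarrow> (nat \<Rightarrow> nat \<Rightarrow> 'w \<Rightarrow> real) \<Rightarrow>
   nat \<Rightarrow> nat \<Rightarrow> real" where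
  "rho_pair P p K I X A g \<epsilon> \<alpha> \<phi> i j =
     (Psi_plus P p K I X A g \<epsilon> i (\<alpha> i j) (\<phi> i j) + Psi_minus P p K I X A g \<epsilon> j (\<alpha> i j) (\<phi> i j)) / 2"

definition kappa_pair ::
  "'w measure \<Rightarrow> ('m \<Rightarrow> 'w \<Rightarrow> real) \<Rightarrow> nat \<Rightarrow> nat \<Rightarrow> (nat \<Rightarrow> 'n::real_inner set) \<Rightarrow>
   (nat \<Rightarrow> 'n \<Rightarrow> 'm) \<Rightarrow> 'n \<Rightarrow> real \<Rightarrow> (nat \<Rightarrow> nat \<Rightarrow> real) \<Rightarrow> (nat \<Rightarrow> nat \<Rightarrow> 'w \<Rightarrow> real) \<Rightarrow>
   nat \<Rightarrow> nat \<Rightarrow> real" where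
  "kappa_pair P p K I X A g \<epsilon> \<alpha> \<phi> i j =
     (Psi_minus P p K I X A g \<epsilon> j (\<alpha> i j) (\<phi> i j) - Psi_plus P p K I X A g \<epsilon> i (\<alpha> i j) (\<phi> i j)) / 2"

definition g_pair ::
  "'w measure \<Rightarrow> ('m \<Rightarrow> 'w \<Rightarrow> real) \<Rightarrow> nat \<Rightarrow> nat \<Rightarrow> (nat \<Rightarrow> 'n::real_inner set) \<Rightarrow>
   (nat \<Rightarrow> 'n \<Rightarrow> 'm) \<Rightarrow> 'n \<Rightarrow> real \<Rightarrow> (nat \<Rightarrow> nat \<Rightarrow> real) \<Rightarrow> (nat \<Rightarrow> nat \<Rightarrow> 'w \<Rightarrow> real) \<Rightarrow>
   nat \<Rightarrow> nat \<Rightarrow> (nat \<Rightarrow> 'w) \<Rightarrow> real" where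
  "g_pair P p K I X A g \<epsilon> \<alpha> \<phi> i j \<omega> =
     (\<Sum>k=1..K. \<phi> i j (\<omega> k)) + kappa_pair P p K I X A g \<epsilon> \<alpha> \<phi> i j"

definition g_hat ::
  "'w measure \<Rightarrow> ('m \<Rightarrow> 'w \<Rightarrow> real) \<Rightarrow> nat \<Rightarrow> nat \<Rightarrow> (nat \<Rightarrow> 'n::real_inner set) \<Rightarrow>
   (nat \<Rightarrow> 'n \<Rightarrow> 'm) \<Rightarrow> 'n \<Rightarrow> real \<Rightarrow> (nat \<Rightarrow> nat \<Rightarrow> real) \<Rightarrow> (nat \<Rightarrow> nat \<Rightarrow> 'w \<Rightarrow> real) \<Rightarrow>
   (nat \<Rightarrow> 'w) \<Rightarrow> real" where
  "g_hat P p K I X A g \<epsilon> \<alpha> \<phi> \<omega> =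
     ((MIN i\<in>{1..I}. MAX j\<in>{1..I}. g_pair P p K I X A g \<epsilon> \<alpha> \<phi> i j \<omega>) +
      (MAX j\<in>{1..I}. MIN i\<in>{1..I}. g_pair P p K I X A g \<epsilon> \<alpha> \<phi> i j \<omega>)) / 2"

definition rho_max ::
  "'w measure \<Rightarrow> ('m \<Rightarrow> 'w \<Rightarrow> real) \<Rightarrow> nat \<Rightarrow> nat \<Rightarrow> (nat \<Rightarrow> 'n::real_inner set) \<Rightarrow>
   (nat \<Rightarrow> 'n \<Rightarrow> 'm) \<Rightarrow> 'n \<Rightarrow> real \<Rightarrow> (nat \<Rightarrow> nat \<Rightarrow> real) \<Rightarrow> (nat \<Rightarrow> nat \<Rightarrow> 'w \<Rightarrow> real) \<Rightarrow>
   nat \<Rightarrow> real" where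
  "rho_max P p K I X A g \<epsilon> \<alpha> \<phi> i =
     (MAX j\<in>{1..I}. max (rho_pair P p K I X A g \<epsilon> \<alpha> \<phi> i j) (rho_pair P p K I X A g \<epsilon> \<alpha> \<phi> j i))"

definition rho_total ::
  "'w measure \<Rightarrow> ('m \<Rightarrow> 'w \<Rightarrow> real) \<Rightarrow> nat \<Rightarrow> nat \<Rightarrow> (nat \<Rightarrow> 'n::real_inner set) \<Rightarrow>
   (nat \<Rightarrow> 'n \<Rightarrow> 'm) \<Rightarrow> 'n \<Rightarrow> real \<Rightarrow> (nat \<Rightarrow> nat \<Rightarrow> real) \<Rightarrow> (nat \<Rightarrow> nat \<Rightarrow> 'w \<Rightarrow> real) \<Rightarrow>
   real" where
  "rho_total P p K I X A g \<epsilon> \<alpha> \<phi> = (MAX i\<in>{1..I}. rho_max P p K I X A g \<epsilon> \<alpha> \<phi> i)"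

end

theory Submission
  imports Defs
begin

text \<open>
  If \<open>x\<close> lies in \<open>X l\<close>, the exponential Markov inequality bounds the probability of each of the
  events \<open>g_pair l j > g \<bullet> x + rho_pair l j\<close> and \<open>g_pair i l < g \<bullet> x - rho_pair i l\<close> by
  \<open>\<epsilon> / (2 * I)\<close>. Outside their union, the \<open>l\<close>-th row of the matrix \<open>g_pair\<close> is at most
  \<open>g \<bullet> x + rho_max l\<close> and its \<open>l\<close>-th column is at least \<open>g \<bullet> x - rho_max l\<close>; since row \<open>l\<close> and
  column \<open>l\<close> meet every column and every row, both the min-max and the max-min of the matrix are
  within \<open>rho_max l\<close> of \<open>g \<bullet> x\<close>.
  The suprema defining the bounds are finite because a concave function on a relatively open set
  has an affine majorant.
\<close>

section \<open>Affine supports and upper bounds on relatively open sets\<close>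

text \<open>A hyperplane with normal \<open>(s, t)\<close> supports the epigraph at its relative
  boundary point \<open>(a, f a)\<close>. Relative openness of \<open>S\<close> rules out a vertical
  hyperplane, so \<open>t > 0\<close>, and dividing by \<open>t\<close> turns the hyperplane into an
  affine minorant of slope \<open>- s / t\<close>.\<close>

lemma convex_on_rel_open_subgradient:
  fixes f :: "'a::euclidean_space \<Rightarrow> real"
  assumes f: "convex_on S f" and S: "rel_open S" and a: "a \<in> S"
  obtains s where "\<And>y. y \<in> S \<Longrightarrow> f a + s \<bullet> (y - a) \<le> f y"
proof -
  let ?H = "epigraph S f"
  have H: "convex ?H" using f by (rule convex_epigraphI)
  have convS: "convex S" using f by (simp add: convex_on_def)
  have aH: "(a, f a) \<in> ?H" using a by (simp add: mem_epigraph)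
  \<comment> \<open>From a relative interior point, the segment starting at
    \<open>(a, f a + 1)\<close> could be prolonged beyond \<open>(a, f a)\<close> inside the
    epigraph, hence below the graph.\<close>
  have "(a, f a) \<notin> rel_interior ?H"
  proof
    assume "(a, f a) \<in> rel_interior ?H"
    moreover have "(a, f a + 1) \<in> affine hull ?H"
      using a by (intro hull_inc) (simp add: mem_epigraph)
    ultimately obtain e where e: "e > 1" "(1 - e) *\<^sub>R (a, f a + 1) + e *\<^sub>R (a, f a) \<in> ?H"
      using convex_rel_interior_if[OF H] by blast
    have "(1 - e) *\<^sub>R a + e *\<^sub>R a = a" by (simp add: algebra_simps)
    with e show False by (simp add: mem_epigraph algebra_simps)
  qed
  then obtain c where le: "\<And>y. y \<in> ?H \<Longrightarrow> c \<bullet> (a, f a) \<le> c \<bullet> y"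
    and less: "\<And>y. y \<in> rel_interior ?H \<Longrightarrow> c \<bullet> (a, f a) < c \<bullet> y"
    using supporting_hyperplane_rel_boundary[OF H aH] by metis
  obtain s t where c: "c = (s, t)" by (cases c)
  have "t \<ge> 0"
    using le[of "(a, f a + 1)"] a by (simp add: c mem_epigraph algebra_simps)
  \<comment> \<open>If the hyperplane were vertical, \<open>s\<close> would be strictly larger at
    some \<open>y\<close> of \<open>S\<close> than at \<open>a\<close>. Prolonging the segment from
    \<open>y\<close> past \<open>a\<close>, still within \<open>S\<close>, reaches a point where
    \<open>s\<close> is smaller than at \<open>a\<close>, against the support property.\<close>
  moreover have "t \<noteq> 0"
  proof
    assume t: "t = 0"
    have "rel_interior ?H \<noteq> {}" using aH rel_interior_eq_empty[OF H] by blast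
    then obtain y v where yv: "(y, v) \<in> rel_interior ?H" by auto
    then have y: "y \<in> S" using rel_interior_subset[of ?H] by (auto simp: mem_epigraph)
    have sy: "s \<bullet> a < s \<bullet> y" using less[OF yv] by (simp add: c t)
    have "a \<in> rel_interior S" using a S by (simp add: rel_open_def)
    then obtain e where e: "e > 1" "(1 - e) *\<^sub>R y + e *\<^sub>R a \<in> S"
      using convex_rel_interior_if[OF convS] hull_inc[OF y] by blast
    let ?z = "(1 - e) *\<^sub>R y + e *\<^sub>R a"
    have "s \<bullet> a \<le> s \<bullet> ?z" using le[of "(?z, f ?z)"] e by (simp add: c t mem_epigraph)
    then have "(e - 1) * (s \<bullet> y) \<le> (e - 1) * (s \<bullet> a)" by (simp add: algebra_simps)
    with e sy show False by simp
  qed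
  ultimately have t: "t > 0" by simp
  show thesis
  proof
    fix y assume "y \<in> S"
    then have "s \<bullet> a + t * f a \<le> s \<bullet> y + t * f y"
      using le[of "(y, f y)"] by (simp add: c mem_epigraph)
    with t show "f a + (- (1 / t) *\<^sub>R s) \<bullet> (y - a) \<le> f y"
      by (simp add: field_simps inner_diff_right)
  qed
qed

text \<open>A subgradient of \<open>- f\<close> at one point of \<open>S\<close> yields an affine
  majorant of \<open>f\<close> on all of \<open>S\<close>, and affine functions are bounded on
  bounded sets.\<close>

lemma concave_on_rel_open_bdd_above:
  fixes f :: "'a::euclidean_space \<Rightarrow> real"
  assumes f: "concave_on S f" and S: "rel_open S" and B: "B \<subseteq> S" "bounded B"
  shows "bdd_above (f ` B)"
proof (cases "B = {}")
  case False
  then obtain a where a: "a \<in> S" using B by blast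
  have "convex_on S (\<lambda>x. - f x)" using f by (simp add: concave_on_def)
  then obtain s where s: "\<And>y. y \<in> S \<Longrightarrow> - f a + s \<bullet> (y - a) \<le> - f y"
    using convex_on_rel_open_subgradient S a by blast
  obtain b where b: "\<And>y. y \<in> B \<Longrightarrow> norm y \<le> b" using B by (auto simp: bounded_iff)
  show ?thesis
  proof (rule bdd_aboveI2)
    fix y assume y: "y \<in> B"
    have "- (s \<bullet> y) \<le> norm s * norm y" using Cauchy_Schwarz_ineq2[of s y] by linarith
    also have "\<dots> \<le> norm s * b" using b[OF y] by (simp add: mult_left_mono)
    finally show "f y \<le> f a + s \<bullet> a + norm s * b"
      using s[of y] y B by (auto simp: inner_diff_right)
  qed
qed auto

lemma affine_map_compact_image:
  fixes f :: "'a::euclidean_space \<Rightarrow> 'b::euclidean_space"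
  assumes "affine_map f" "compact S"
  shows "compact (f ` S)"
proof -
  obtain L c where L: "linear L" "\<And>x. f x = L x + c"
    using assms by (auto simp: affine_map_def)
  have "continuous_on S f"
    unfolding L(2) using L(1) by (intro continuous_intros linear_continuous_on linear_linear[THEN iffD2])
  then show ?thesis using assms compact_continuous_image by blast
qed

section \<open>Min-max and max-min of a finite matrix\<close>

text \<open>By contraposition. A bound \<open>c + r\<close> on row \<open>l\<close> limits the
  smallest row maximum, through the choice \<open>i = l\<close>, and every column minimum, through
  its entry in row \<open>l\<close>. Column \<open>l\<close> gives the lower bounds
  \<open>c - r\<close> dually, and the mean of two numbers in an interval stays there.\<close>

lemma MIN_MAX_MAX_MIN_deviation_less:
  fixes G :: "'i \<Rightarrow> 'i \<Rightarrow> real"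
  assumes l: "l \<in> N" and N: "finite N"
    and r: "\<bar>((MIN i\<in>N. MAX j\<in>N. G i j) + (MAX j\<in>N. MIN i\<in>N. G i j)) / 2 - c\<bar> > r"
  shows "(\<exists>j\<in>N. G l j > c + r) \<or> (\<exists>i\<in>N. G i l < c - r)"
proof (rule ccontr)
  assume "\<not> ?thesis"
  then have row: "G l j \<le> c + r" and col: "G j l \<ge> c - r" if "j \<in> N" for j
    using that by (auto simp: not_less)
  have mean: "\<bar>(a + b) / 2 - c\<bar> \<le> r" if "a \<le> c + r" "a \<ge> c - r" "c - r \<le> b" "b \<le> c + r" for a b
    using that by (auto simp: abs_le_iff field_simps)
  have "(MIN i\<in>N. MAX j\<in>N. G i j) \<le> (MAX j\<in>N. G l j)" using N l by auto
  also have "\<dots> \<le> c + r" using N l row by (subst Max_le_iff) auto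
  finally have "(MIN i\<in>N. MAX j\<in>N. G i j) \<le> c + r" .
  moreover have "(MIN i\<in>N. MAX j\<in>N. G i j) \<ge> c - r"
    using N l col by (subst Min_ge_iff) (auto intro: order_trans[OF col Max_ge])
  moreover have "c - r \<le> (MAX j\<in>N. MIN i\<in>N. G i j)"
  proof -
    have "c - r \<le> (MIN i\<in>N. G i l)" using N l col by (subst Min_ge_iff) auto
    also have "\<dots> \<le> (MAX j\<in>N. MIN i\<in>N. G i j)" using N l by auto
    finally show ?thesis .
  qed
  moreover have "(MAX j\<in>N. MIN i\<in>N. G i j) \<le> c + r"
    using N l row by (subst Max_le_iff) (auto intro: order_trans[OF Min_le row])
  ultimately have "\<bar>((MIN i\<in>N. MAX j\<in>N. G i j) + (MAX j\<in>N. MIN i\<in>N. G i j)) / 2 - c\<bar> \<le> r"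
    by (rule mean)
  then show False using r by simp
qed

section \<open>Measurability and exponential moments in a good observation scheme\<close>

context good_observation_scheme
begin

lemma F_borel: "\<phi> \<in> \<F> \<Longrightarrow> \<phi> \<in> borel_measurable P"
  using borel_measurable_continuous_onI[OF F_cont] by (simp add: measurable_cong_sets[OF sets_P refl])

lemma p_borel:
  assumes "\<mu> \<in> \<M>" shows "p \<mu> \<in> borel_measurable P"
proof -
  have "continuous_on UNIV (\<lambda>\<omega>. (\<lambda>(\<mu>, \<omega>). p \<mu> \<omega>) (\<mu>, \<omega>))"
    by (rule continuous_on_compose2[OF p_cont]) (use assms in \<open>auto intro!: continuous_intros\<close>)
  then show ?thesis
    using borel_measurable_continuous_onI by (simp add: measurable_cong_sets[OF sets_P refl])
qed

text \<open>Makes \<open>Phi\<close> available at \<open>\<psi> / \<beta>\<close> and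
  \<open>- \<psi> / \<beta>\<close>, the arguments that occur in \<open>Psi_plus\<close> and
  \<open>Psi_minus\<close>.\<close>

lemma F_scale:
  assumes "\<phi> \<in> \<F>" shows "(\<lambda>\<omega>. c * \<phi> \<omega>) \<in> \<F>"
proof -
  interpret V: vector_space "fun_scale :: real \<Rightarrow> ('a \<Rightarrow> real) \<Rightarrow> 'a \<Rightarrow> real"
    by (rule vector_space_fun_scale)
  show ?thesis
    using F_space assms V.subspace_scale[of \<F> \<phi> c]
    by (simp add: finite_dim_function_space_def fun_scale_def)
qed

text \<open>Since \<open>Phi\<close> is the logarithm of this integral, the point is that the
  integral is finite and positive, so that \<open>exp\<close> inverts \<open>ln\<close>.\<close>

lemma nn_integral_exp_eq_Phi:
  assumes \<phi>: "\<phi> \<in> \<F>" and \<mu>: "\<mu> \<in> \<M>"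
  shows "(\<integral>\<^sup>+\<omega>. ennreal (exp (\<phi> \<omega>) * p \<mu> \<omega>) \<partial>P) = ennreal (exp (Phi P p \<phi> \<mu>))"
proof -
  let ?f = "\<lambda>\<omega>. exp (\<phi> \<omega>) * p \<mu> \<omega>"
  have pos: "?f \<omega> > 0" for \<omega> using p_pos[OF \<mu>] by simp
  have int: "integrable P ?f" using \<phi> \<mu> by (rule Phi_finite)
  have eq: "(\<integral>\<^sup>+\<omega>. ennreal (?f \<omega>) \<partial>P) = ennreal (\<integral>\<omega>. ?f \<omega> \<partial>P)"
    using int pos by (intro nn_integral_eq_integral) (auto intro: less_imp_le)
  \<comment> \<open>The exponential factor never vanishes, so a zero integral would make the density
    \<open>p \<mu>\<close> zero almost everywhere, although its total mass is 1.\<close>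
  have "(\<integral>\<^sup>+\<omega>. ennreal (?f \<omega>) \<partial>P) \<noteq> 0"
  proof
    assume "(\<integral>\<^sup>+\<omega>. ennreal (?f \<omega>) \<partial>P) = 0"
    then have "AE \<omega> in P. ennreal (?f \<omega>) = 0"
      using int by (subst (asm) nn_integral_0_iff_AE) auto
    then have "AE \<omega> in P. ennreal (p \<mu> \<omega>) = 0"
      by eventually_elim (use pos in \<open>auto simp: ennreal_eq_0_iff mult_le_0_iff\<close>)
    then have "(\<integral>\<^sup>+\<omega>. ennreal (p \<mu> \<omega>) \<partial>P) = 0"
      using p_borel[OF \<mu>] by (subst nn_integral_0_iff_AE) auto
    with p_density[OF \<mu>] show False by simp
  qed
  then have "(\<integral>\<omega>. ?f \<omega> \<partial>P) > 0" by (simp add: eq ennreal_eq_0_iff)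
  then show ?thesis by (simp add: eq Phi_def)
qed

text \<open>Chernoff bound with exponent \<open>1 / \<alpha>\<close>: the indicator of the event is
  dominated by a constant times \<open>exp\<close> of the sum of \<open>\<phi> / \<alpha>\<close>,
  and the integral of that exponential factorizes over the \<open>K\<close> independent
  observations.\<close>

lemma emeasure_obs_distr_sum_greater:
  assumes \<phi>: "\<phi> \<in> \<F>" and \<mu>: "\<mu> \<in> \<M>" and \<alpha>: "\<alpha> > 0" and \<delta>: "\<delta> > 0"
    and t: "t \<ge> real K * \<alpha> * Phi P p (\<lambda>\<omega>. \<phi> \<omega> / \<alpha>) \<mu> + \<alpha> * ln (1 / \<delta>)"
  shows "emeasure (obs_distr P p K \<mu>) {\<omega> \<in> space (obs_space P K). (\<Sum>k=1..K. \<phi> (\<omega> k)) > t} \<le> ennreal \<delta>"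
proof -
  interpret product_sigma_finite "\<lambda>_::nat. P" by unfold_locales
  define \<psi> where "\<psi> = (\<lambda>\<omega>. \<phi> \<omega> / \<alpha>)"
  have \<psi>: "\<psi> \<in> \<F>" using F_scale[OF \<phi>, of "1 / \<alpha>"] by (simp add: \<psi>_def)
  note [measurable] = F_borel[OF \<phi>] F_borel[OF \<psi>] p_borel[OF \<mu>]
  let ?E = "{\<omega> \<in> space (obs_space P K). (\<Sum>k=1..K. \<phi> (\<omega> k)) > t}"
  \<comment> \<open>The hypothesis on \<open>t\<close> says exactly that
    \<open>exp (- t / \<alpha>)\<close> is at most this constant, which is scaled so that the final
    bound is \<open>\<delta>\<close>.\<close>
  let ?c = "\<delta> * exp (- real K * Phi P p \<psi> \<mu>)"
  have E: "?E \<in> sets (obs_space P K)" unfolding obs_space_def by measurable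
  have d: "(\<lambda>\<omega>. ennreal (\<Prod>k=1..K. p \<mu> (\<omega> k))) \<in> borel_measurable (obs_space P K)"
    unfolding obs_space_def by measurable
  have "emeasure (obs_distr P p K \<mu>) ?E
      = (\<integral>\<^sup>+\<omega>. ennreal (\<Prod>k=1..K. p \<mu> (\<omega> k)) * indicator ?E \<omega> \<partial>obs_space P K)"
    unfolding obs_distr_def by (rule emeasure_density[OF d E])
  also have "\<dots> \<le> (\<integral>\<^sup>+\<omega>. ennreal ?c * (\<Prod>k=1..K. ennreal (exp (\<psi> (\<omega> k)) * p \<mu> (\<omega> k))) \<partial>obs_space P K)"
  proof (rule nn_integral_mono)
    fix \<omega> assume "\<omega> \<in> space (obs_space P K)"
    have pp: "(\<Prod>k=1..K. p \<mu> (\<omega> k)) \<ge> 0" using p_pos[OF \<mu>] by (intro prod_nonneg) (auto intro: less_imp_le)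
    have nn: "exp (\<psi> (\<omega> k)) * p \<mu> (\<omega> k) \<ge> 0" for k using p_pos[OF \<mu>, of "\<omega> k"] by simp
    have rhs: "ennreal ?c * (\<Prod>k=1..K. ennreal (exp (\<psi> (\<omega> k)) * p \<mu> (\<omega> k)))
        = ennreal (?c * exp (\<Sum>k=1..K. \<psi> (\<omega> k)) * (\<Prod>k=1..K. p \<mu> (\<omega> k)))"
    proof -
      have "(\<Prod>k=1..K. ennreal (exp (\<psi> (\<omega> k)) * p \<mu> (\<omega> k)))
          = ennreal (exp (\<Sum>k=1..K. \<psi> (\<omega> k)) * (\<Prod>k=1..K. p \<mu> (\<omega> k)))"
        by (subst prod_ennreal[OF nn]) (simp add: prod.distrib exp_sum)
      moreover have "?c \<ge> 0" using \<delta> by simp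
      ultimately show ?thesis
        by (subst mult.assoc, subst ennreal_mult'[of ?c]) simp_all
    qed
    show "ennreal (\<Prod>k=1..K. p \<mu> (\<omega> k)) * indicator ?E \<omega>
        \<le> ennreal ?c * (\<Prod>k=1..K. ennreal (exp (\<psi> (\<omega> k)) * p \<mu> (\<omega> k)))"
    proof (cases "\<omega> \<in> ?E")
      case True
      then have "\<alpha> * (real K * Phi P p \<psi> \<mu> - ln \<delta>) < \<alpha> * (\<Sum>k=1..K. \<psi> (\<omega> k))"
        using t \<alpha> \<delta> by (simp add: \<psi>_def ln_div algebra_simps flip: sum_divide_distrib)
      then have "0 \<le> ln \<delta> + - real K * Phi P p \<psi> \<mu> + (\<Sum>k=1..K. \<psi> (\<omega> k))"
        using \<alpha> by simp
      then have "1 \<le> exp (ln \<delta> + - real K * Phi P p \<psi> \<mu> + (\<Sum>k=1..K. \<psi> (\<omega> k)))"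
        by (simp only: one_le_exp_iff)
      then have "1 \<le> ?c * exp (\<Sum>k=1..K. \<psi> (\<omega> k))"
        using \<delta> by (simp only: exp_add exp_ln)
      from mult_right_mono[OF this pp] show ?thesis
        using True by (simp only: rhs) (auto intro: ennreal_leI)
    qed simp
  qed
  also have "\<dots> = ennreal ?c * (\<integral>\<^sup>+\<omega>. (\<Prod>k=1..K. ennreal (exp (\<psi> (\<omega> k)) * p \<mu> (\<omega> k))) \<partial>obs_space P K)"
    unfolding obs_space_def by (rule nn_integral_cmult) measurable
  \<comment> \<open>Fubini for the product measure: each coordinate contributes the same factor
    \<open>exp (Phi P p \<psi> \<mu>)\<close>.\<close>
  also have "\<dots> = ennreal ?c * ennreal (exp (Phi P p \<psi> \<mu>)) ^ K"
    unfolding obs_space_def by (subst product_nn_integral_prod) (auto simp: nn_integral_exp_eq_Phi[OF \<psi> \<mu>])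
  also have "\<dots> = ennreal \<delta>"
    using \<delta> by (simp add: ennreal_power flip: ennreal_mult' exp_of_nat_mult exp_add mult.assoc)
  finally show ?thesis .
qed

section \<open>Finiteness of the suprema \<open>Psi_plus\<close> and
  \<open>Psi_minus\<close>\<close>

lemma bdd_above_Phi_affine:
  fixes S :: "(real ^ 'n) set"
  assumes \<psi>: "\<psi> \<in> \<F>" and S: "compact S" and A: "affine_map A" and AM: "A ` S \<subseteq> \<M>" and c: "c \<ge> 0"
  shows "bdd_above ((\<lambda>x. c * Phi P p \<psi> (A x) + h \<bullet> x + d) ` S)"
proof -
  have "bdd_above (Phi P p \<psi> ` A ` S)"
    using AM compact_imp_bounded[OF affine_map_compact_image[OF A S]]
    by (rule concave_on_rel_open_bdd_above[OF Phi_concave[OF \<psi>] rel_open_M])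
  then obtain b where b: "\<And>x. x \<in> S \<Longrightarrow> Phi P p \<psi> (A x) \<le> b" by (auto simp: bdd_above_def)
  obtain b' where b': "\<And>x. x \<in> S \<Longrightarrow> norm x \<le> b'"
    using compact_imp_bounded[OF S] by (auto simp: bounded_iff)
  show ?thesis
  proof (rule bdd_aboveI2)
    fix x assume x: "x \<in> S"
    have "h \<bullet> x \<le> norm h * norm x" by (rule norm_cauchy_schwarz)
    also have "\<dots> \<le> norm h * b'" using b'[OF x] by (simp add: mult_left_mono)
    finally show "c * Phi P p \<psi> (A x) + h \<bullet> x + d \<le> c * b + norm h * b' + d"
      using mult_left_mono[OF b[OF x] c] by simp
  qed
qed

lemma Psi_plus_upper:
  fixes X :: "nat \<Rightarrow> (real ^ 'n) set"
  assumes "\<psi> \<in> \<F>" "\<beta> > 0" "compact (X l)" "affine_map (A l)" "A l ` X l \<subseteq> \<M>" "x \<in> X l"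
  shows "real K * \<beta> * Phi P p (\<lambda>\<omega>. \<psi> \<omega> / \<beta>) (A l x) - g \<bullet> x + \<beta> * ln (2 * real I / \<epsilon>)
      \<le> Psi_plus P p K I X A g \<epsilon> l \<beta> \<psi>"
  unfolding Psi_plus_def
  using bdd_above_Phi_affine[of "\<lambda>\<omega>. \<psi> \<omega> / \<beta>" "X l" "A l" "real K * \<beta>" "- g" "\<beta> * ln (2 * real I / \<epsilon>)"]
    F_scale[of \<psi> "1 / \<beta>"] assms
  by (intro cSUP_upper) auto

lemma Psi_minus_upper:
  fixes X :: "nat \<Rightarrow> (real ^ 'n) set"
  assumes "\<psi> \<in> \<F>" "\<beta> > 0" "compact (X l)" "affine_map (A l)" "A l ` X l \<subseteq> \<M>" "x \<in> X l"
  shows "real K * \<beta> * Phi P p (\<lambda>\<omega>. - \<psi> \<omega> / \<beta>) (A l x) + g \<bullet> x + \<beta> * ln (2 * real I / \<epsilon>)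
      \<le> Psi_minus P p K I X A g \<epsilon> l \<beta> \<psi>"
  unfolding Psi_minus_def
  using bdd_above_Phi_affine[of "\<lambda>\<omega>. - \<psi> \<omega> / \<beta>" "X l" "A l" "real K * \<beta>" g "\<beta> * ln (2 * real I / \<epsilon>)"]
    F_scale[of \<psi> "- 1 / \<beta>"] assms
  by (intro cSUP_upper) auto

section \<open>Measurability and deviation probabilities of the estimate\<close>

lemma g_pair_measurable:
  assumes "\<phi> i j \<in> \<F>"
  shows "g_pair P p K I X A g \<epsilon> \<alpha> \<phi> i j \<in> borel_measurable (obs_space P K)"
proof -
  note [measurable] = F_borel[OF assms]
  have "(\<lambda>\<omega>. g_pair P p K I X A g \<epsilon> \<alpha> \<phi> i j \<omega>) \<in> borel_measurable (obs_space P K)"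
    unfolding g_pair_def obs_space_def by measurable
  then show ?thesis by simp
qed

lemma g_hat_measurable:
  assumes "\<And>i j. i \<in> {1..I} \<Longrightarrow> j \<in> {1..I} \<Longrightarrow> \<phi> i j \<in> \<F>"
  shows "g_hat P p K I X A g \<epsilon> \<alpha> \<phi> \<in> borel_measurable (obs_space P K)"
proof -
  have "(\<lambda>\<omega>. g_hat P p K I X A g \<epsilon> \<alpha> \<phi> \<omega>) \<in> borel_measurable (obs_space P K)"
    unfolding g_hat_def
    by (intro borel_measurable_divide borel_measurable_add borel_measurable_Min
        borel_measurable_Max borel_measurable_const g_pair_measurable assms) auto
  then show ?thesis by simp
qed

text \<open>The shift is chosen so that \<open>rho_pair - kappa_pair\<close> equals
  \<open>Psi_plus\<close>. The event thus forces the sum of the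
  \<open>\<phi> i j (\<omega> k)\<close> above \<open>g \<bullet> x + Psi_plus\<close>, a threshold
  to which the Chernoff bound applies with \<open>\<delta> = \<epsilon> / (2 * I)\<close>.\<close>

lemma emeasure_g_pair_greater:
  fixes X :: "nat \<Rightarrow> (real ^ 'n) set"
  assumes "\<phi> i j \<in> \<F>" "\<alpha> i j > 0" "compact (X i)" "affine_map (A i)" "A i ` X i \<subseteq> \<M>" "x \<in> X i"
    and "I \<ge> 1" "\<epsilon> > 0" and r: "r \<ge> rho_pair P p K I X A g \<epsilon> \<alpha> \<phi> i j"
  shows "emeasure (obs_distr P p K (A i x))
      {\<omega> \<in> space (obs_space P K). g_pair P p K I X A g \<epsilon> \<alpha> \<phi> i j \<omega> > g \<bullet> x + r} \<le> ennreal (\<epsilon> / (2 * real I))"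
proof -
  let ?t = "g \<bullet> x + r - kappa_pair P p K I X A g \<epsilon> \<alpha> \<phi> i j"
  have "?t \<ge> g \<bullet> x + Psi_plus P p K I X A g \<epsilon> i (\<alpha> i j) (\<phi> i j)"
    using r by (simp add: rho_pair_def kappa_pair_def field_simps)
  with Psi_plus_upper[of "\<phi> i j" "\<alpha> i j" X i A x K g I \<epsilon>] assms
  have t: "?t \<ge> real K * \<alpha> i j * Phi P p (\<lambda>\<omega>. \<phi> i j \<omega> / \<alpha> i j) (A i x) + \<alpha> i j * ln (1 / (\<epsilon> / (2 * real I)))"
    by simp
  have "{\<omega> \<in> space (obs_space P K). g_pair P p K I X A g \<epsilon> \<alpha> \<phi> i j \<omega> > g \<bullet> x + r}
      = {\<omega> \<in> space (obs_space P K). (\<Sum>k=1..K. \<phi> i j (\<omega> k)) > ?t}"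
    by (auto simp: g_pair_def)
  then show ?thesis
    using emeasure_obs_distr_sum_greater[OF _ _ _ _ t] assms by auto
qed

text \<open>Mirror image of the upper deviation: \<open>rho_pair + kappa_pair\<close> equals
  \<open>Psi_minus\<close>, and the Chernoff bound is applied to
  \<open>- \<phi> i j\<close>.\<close>

lemma emeasure_g_pair_less:
  fixes X :: "nat \<Rightarrow> (real ^ 'n) set"
  assumes "\<phi> i j \<in> \<F>" "\<alpha> i j > 0" "compact (X j)" "affine_map (A j)" "A j ` X j \<subseteq> \<M>" "x \<in> X j"
    and "I \<ge> 1" "\<epsilon> > 0" and r: "r \<ge> rho_pair P p K I X A g \<epsilon> \<alpha> \<phi> i j"
  shows "emeasure (obs_distr P p K (A j x))
      {\<omega> \<in> space (obs_space P K). g_pair P p K I X A g \<epsilon> \<alpha> \<phi> i j \<omega> < g \<bullet> x - r} \<le> ennreal (\<epsilon> / (2 * real I))"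
proof -
  let ?t = "r + kappa_pair P p K I X A g \<epsilon> \<alpha> \<phi> i j - g \<bullet> x"
  have "?t \<ge> Psi_minus P p K I X A g \<epsilon> j (\<alpha> i j) (\<phi> i j) - g \<bullet> x"
    using r by (simp add: rho_pair_def kappa_pair_def field_simps)
  with Psi_minus_upper[of "\<phi> i j" "\<alpha> i j" X j A x K g I \<epsilon>] assms
  have t: "?t \<ge> real K * \<alpha> i j * Phi P p (\<lambda>\<omega>. - \<phi> i j \<omega> / \<alpha> i j) (A j x) + \<alpha> i j * ln (1 / (\<epsilon> / (2 * real I)))"
    by simp
  have "{\<omega> \<in> space (obs_space P K). g_pair P p K I X A g \<epsilon> \<alpha> \<phi> i j \<omega> < g \<bullet> x - r}
      = {\<omega> \<in> space (obs_space P K). (\<Sum>k=1..K. - \<phi> i j (\<omega> k)) > ?t}"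
    by (auto simp: g_pair_def sum_negf)
  then show ?thesis
    using emeasure_obs_distr_sum_greater[OF _ _ _ _ t] F_scale[of "\<phi> i j" "- 1"] assms by auto
qed

text \<open>Union bound over \<open>2 * I\<close> events, two for each index \<open>j\<close>, of
  probability at most \<open>\<epsilon> / (2 * I)\<close> each. The free radius \<open>r\<close>
  covers both \<open>rho_max\<close> at \<open>l\<close> and the larger
  \<open>rho_total\<close>.\<close>

lemma prob_g_hat_deviation:
  fixes X :: "nat \<Rightarrow> (real ^ 'n) set"
  assumes \<phi>: "\<And>i j. i \<in> {1..I} \<Longrightarrow> j \<in> {1..I} \<Longrightarrow> \<phi> i j \<in> \<F>"
    and \<alpha>: "\<And>i j. i \<in> {1..I} \<Longrightarrow> j \<in> {1..I} \<Longrightarrow> \<alpha> i j > 0"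
    and l: "l \<in> {1..I}" and X: "compact (X l)" "affine_map (A l)" "A l ` X l \<subseteq> \<M>" "x \<in> X l"
    and \<epsilon>: "\<epsilon> > 0" and r: "r \<ge> rho_max P p K I X A g \<epsilon> \<alpha> \<phi> l"
  shows "\<P>(\<omega> in obs_distr P p K (A l x). \<bar>g_hat P p K I X A g \<epsilon> \<alpha> \<phi> \<omega> - g \<bullet> x\<bar> > r) \<le> \<epsilon>"
proof -
  let ?N = "obs_distr P p K (A l x)" and ?S = "space (obs_space P K)"
  let ?g = "g_pair P p K I X A g \<epsilon> \<alpha> \<phi>" and ?\<rho> = "rho_pair P p K I X A g \<epsilon> \<alpha> \<phi>"
  let ?U = "\<lambda>j. {\<omega> \<in> ?S. ?g l j \<omega> > g \<bullet> x + r}" and ?L = "\<lambda>i. {\<omega> \<in> ?S. ?g i l \<omega> < g \<bullet> x - r}"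
  have I: "I \<ge> 1" using l by simp
  have sp: "space ?N = ?S" "sets ?N = sets (obs_space P K)" by (simp_all add: obs_distr_def)
  \<comment> \<open>Row \<open>l\<close> and column \<open>l\<close> both matter, which is why
    \<open>rho_max\<close> takes the maximum over both orders of the indices.\<close>
  have \<rho>: "?\<rho> l j \<le> r" "?\<rho> j l \<le> r" if "j \<in> {1..I}" for j
  proof -
    have "max (?\<rho> l j) (?\<rho> j l) \<le> rho_max P p K I X A g \<epsilon> \<alpha> \<phi> l"
      unfolding rho_max_def using that by (intro Max_ge) auto
    with r show "?\<rho> l j \<le> r" "?\<rho> j l \<le> r" by auto
  qed
  have U: "?U j \<in> sets ?N" and L: "?L j \<in> sets ?N" if "j \<in> {1..I}" for j
    using g_pair_measurable[of \<phi> l j K I X A g \<epsilon> \<alpha>] g_pair_measurable[of \<phi> j l K I X A g \<epsilon> \<alpha>] \<phi> l that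
    unfolding sp by auto
  have "emeasure ?N (\<Union>j\<in>{1..I}. ?U j \<union> ?L j) \<le> (\<Sum>j\<in>{1..I}. emeasure ?N (?U j \<union> ?L j))"
    using U L by (intro emeasure_subadditive_finite) auto
  also have "\<dots> \<le> (\<Sum>j\<in>{1..I}. ennreal (\<epsilon> / (2 * real I)) + ennreal (\<epsilon> / (2 * real I)))"
  proof (rule sum_mono)
    fix j assume j: "j \<in> {1..I}"
    have "emeasure ?N (?U j \<union> ?L j) \<le> emeasure ?N (?U j) + emeasure ?N (?L j)"
      using U L j by (intro emeasure_subadditive) auto
    also have "\<dots> \<le> ennreal (\<epsilon> / (2 * real I)) + ennreal (\<epsilon> / (2 * real I))"
      using j l \<rho>[OF j] \<phi> \<alpha> X I \<epsilon>
      by (intro add_mono emeasure_g_pair_greater emeasure_g_pair_less) auto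
    finally show "emeasure ?N (?U j \<union> ?L j) \<le> ennreal (\<epsilon> / (2 * real I)) + ennreal (\<epsilon> / (2 * real I))" .
  qed
  also have "\<dots> = ennreal \<epsilon>"
    using I \<epsilon> by (simp add: ennreal_of_nat_eq_real_of_nat flip: ennreal_plus ennreal_mult')
  finally have union: "emeasure ?N (\<Union>j\<in>{1..I}. ?U j \<union> ?L j) \<le> ennreal \<epsilon>" .
  \<comment> \<open>The matrix lemma, applied pointwise in \<open>\<omega>\<close>: a large error of
    the estimate must show up in row \<open>l\<close> or in column \<open>l\<close>.\<close>
  have "{\<omega> \<in> ?S. \<bar>g_hat P p K I X A g \<epsilon> \<alpha> \<phi> \<omega> - g \<bullet> x\<bar> > r} \<subseteq> (\<Union>j\<in>{1..I}. ?U j \<union> ?L j)"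
  proof
    fix \<omega> assume "\<omega> \<in> {\<omega> \<in> ?S. \<bar>g_hat P p K I X A g \<epsilon> \<alpha> \<phi> \<omega> - g \<bullet> x\<bar> > r}"
    then show "\<omega> \<in> (\<Union>j\<in>{1..I}. ?U j \<union> ?L j)"
      using MIN_MAX_MAX_MIN_deviation_less[OF l, of r "\<lambda>i j. ?g i j \<omega>" "g \<bullet> x"]
      by (auto simp: g_hat_def)
  qed
  then have "emeasure ?N {\<omega> \<in> ?S. \<bar>g_hat P p K I X A g \<epsilon> \<alpha> \<phi> \<omega> - g \<bullet> x\<bar> > r} \<le> ennreal \<epsilon>"
    using U L by (intro order_trans[OF emeasure_mono union]) auto
  then show ?thesis
    using \<epsilon> by (simp add: measure_def sp enn2real_leI)
qed

end

section \<open>The overall radius and the risk bound\<close>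

text \<open>Symmetrizing inside \<open>rho_max\<close> only exchanges the indices of a pair, so no
  new values enter, while each \<open>rho_pair i j\<close> already occurs in \<open>rho_max\<close>
  at \<open>i\<close>.\<close>

lemma rho_total_eq:
  assumes "I \<ge> 1"
  shows "rho_total P p K I X A g \<epsilon> \<alpha> \<phi> =
    (MAX (i, j)\<in>{1..I} \<times> {1..I}. rho_pair P p K I X A g \<epsilon> \<alpha> \<phi> i j)" (is "_ = ?R")
proof (rule antisym)
  let ?\<rho> = "rho_pair P p K I X A g \<epsilon> \<alpha> \<phi>" and ?m = "rho_max P p K I X A g \<epsilon> \<alpha> \<phi>"
  have ne: "{1..I} \<noteq> {}" using assms by simp
  have le: "?\<rho> i j \<le> ?R" if "i \<in> {1..I}" "j \<in> {1..I}" for i j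
    using that by (intro Max_ge) force+
  have "?m i \<le> ?R" if "i \<in> {1..I}" for i
    unfolding rho_max_def using ne le that by (subst Max_le_iff) auto
  then show "rho_total P p K I X A g \<epsilon> \<alpha> \<phi> \<le> ?R"
    unfolding rho_total_def using ne by (subst Max_le_iff) auto
  have "?\<rho> i j \<le> rho_total P p K I X A g \<epsilon> \<alpha> \<phi>" if "i \<in> {1..I}" "j \<in> {1..I}" for i j
  proof -
    have "?\<rho> i j \<le> max (?\<rho> i j) (?\<rho> j i)" by simp
    also have "\<dots> \<le> ?m i" unfolding rho_max_def using that by (intro Max_ge) auto
    also have "\<dots> \<le> rho_total P p K I X A g \<epsilon> \<alpha> \<phi>"
      unfolding rho_total_def using that by (intro Max_ge) auto
    finally show ?thesis .
  qed
  then show "?R \<le> rho_total P p K I X A g \<epsilon> \<alpha> \<phi>"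
    using ne by (subst Max_le_iff) auto
qed

theorem proposition3p1:
  fixes P :: "'w::polish_space measure"
    and \<M> :: "(real ^ 'm) set"
    and p :: "real ^ 'm \<Rightarrow> 'w \<Rightarrow> real"
    and \<F> :: "('w \<Rightarrow> real) set"
    and K I :: nat
    and \<epsilon> :: real
    and X :: "nat \<Rightarrow> (real ^ 'n) set"
    and A :: "nat \<Rightarrow> real ^ 'n \<Rightarrow> real ^ 'm"
    and g :: "real ^ 'n"
    and \<alpha> :: "nat \<Rightarrow> nat \<Rightarrow> real"
    and \<phi> :: "nat \<Rightarrow> nat \<Rightarrow> 'w \<Rightarrow> real"
  assumes "good_observation_scheme P \<M> p \<F>"
    and "K \<ge> 1" and "I \<ge> 1"
    and "0 < \<epsilon>" and "\<epsilon> < 1"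
    and "\<And>j. j \<in> {1..I} \<Longrightarrow> X j \<noteq> {} \<and> convex (X j) \<and> compact (X j)"
    and "\<And>j. j \<in> {1..I} \<Longrightarrow> affine_map (A j)"
    and "\<And>j x. j \<in> {1..I} \<Longrightarrow> x \<in> X j \<Longrightarrow> A j x \<in> \<M>"
    and "\<And>i j. i \<in> {1..I} \<Longrightarrow> j \<in> {1..I} \<Longrightarrow> \<alpha> i j > 0"
    and "\<And>i j. i \<in> {1..I} \<Longrightarrow> j \<in> {1..I} \<Longrightarrow> \<phi> i j \<in> \<F>"
  shows "(\<forall>l\<in>{1..I}. \<forall>x\<in>X l.
            \<P>(\<omega> in obs_distr P p K (A l x).
               \<bar>g_hat P p K I X A g \<epsilon> \<alpha> \<phi> \<omega> - g \<bullet> x\<bar> > rho_max P p K I X A g \<epsilon> \<alpha> \<phi> l) \<le> \<epsilon>)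
       \<and> rho_total P p K I X A g \<epsilon> \<alpha> \<phi> =
           (MAX (i, j)\<in>{1..I} \<times> {1..I}. rho_pair P p K I X A g \<epsilon> \<alpha> \<phi> i j)
       \<and> Risk P p K I X A g \<epsilon> (g_hat P p K I X A g \<epsilon> \<alpha> \<phi>)
           \<le> ereal (rho_total P p K I X A g \<epsilon> \<alpha> \<phi>)"
proof -
  interpret good_observation_scheme P \<M> p \<F> by fact
  let ?gh = "g_hat P p K I X A g \<epsilon> \<alpha> \<phi>" and ?\<rho> = "rho_total P p K I X A g \<epsilon> \<alpha> \<phi>"
  \<comment> \<open>Used twice: with \<open>r\<close> equal to \<open>rho_max\<close> at
    \<open>l\<close> for the individual bounds, and with \<open>r = rho_total\<close>, one radius
    valid for all \<open>l\<close>, for reliability. The infimum defining \<open>Risk\<close> is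
    then at most this admissible radius.\<close>
  have dev: "\<P>(\<omega> in obs_distr P p K (A l x). \<bar>?gh \<omega> - g \<bullet> x\<bar> > r) \<le> \<epsilon>"
    if "l \<in> {1..I}" "x \<in> X l" "r \<ge> rho_max P p K I X A g \<epsilon> \<alpha> \<phi> l" for l x r
    using that assms by (intro prob_g_hat_deviation) auto
  have "rho_max P p K I X A g \<epsilon> \<alpha> \<phi> l \<le> ?\<rho>" if "l \<in> {1..I}" for l
    unfolding rho_total_def using that by (intro Max_ge) auto
  then have "reliable P p K I X A g ?gh ?\<rho> \<epsilon>"
    unfolding reliable_def using dev g_hat_measurable assms by blast
  then have "Risk P p K I X A g \<epsilon> ?gh \<le> ereal ?\<rho>"
    unfolding Risk_def by (intro Inf_lower) auto
  with dev rho_total_eq[OF \<open>I \<ge> 1\<close>] show ?thesis by blast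
qed

end
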